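(* Let $\mathcal{D}^T$ be the target distribution, with marginals over image–class pairs $(x,c)$, $c\in\{0,\dots,K\}$, and over image–box pairs $(x,b)$. Suppose the pseudo class-labels $\hat c$ are generated by a teacher with class-conditional transition matrix $T\in[0,1]^{(K+1)\times(K+1)}$, $T_{ji}=\Pr[\hat c=i\mid c=j]$, $\sum_{i=0}^{K}T_{ji}=1$ for every $j$, satisfying $\lambda=\min_j T_{jj}>0$. Suppose the bounding-box pseudo-labels $\hat b=f_r^{te}(x)$, output by a teacher regressor $f_r^{te}$, have noise rate $\eta_{reg}=\mathbb{E}_{(x,b)}\bigl[M(x,b)\,\|\hat b-b\|_1\bigr]$, and let $\zeta=\mathbb{E}_{(x,b)}[1-M(x,b)]$ be the teacher's miss-rate for ground-truth boxes, where $M(x,b)=\mathbf 1[\mathrm{IoU}(\hat b,b)\ge\tau]$ for the IoU threshold $\tau$. Assume all boxes are normalized to the unit square, so that $\|u-v\|_1\le 2$ for any two boxes $u,v$. Then, for any student heads $(f_c^{st},f_r^{st})$, $$R^{\det}_{\mathcal{D}^T}\bigl(f_c^{st},f_r^{st}\bigr)\;\le\;\frac{1}{\lambda}\,R^{cls}_{\mathcal{D}^T,\,noisy}\bigl(f_c^{st}\bigr)+R^{reg}_{\mathcal{D}^T,\,noisy}\bigl(f_r^{st}\bigr)+\eta_{reg}+2\,\zeta .$$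
   Context: The student heads are a classifier $f_c^{st}$, which maps an input image $x$ to class probabilities $p(x)=(p_0(x),\dots,p_K(x))$ (a softmax over $K+1$ classes), and a regressor $f_r^{st}$, which maps $x$ to a box, i.e. a vector of bounding-box coordinates in $\mathbb{R}^4$. $\mathrm{IoU}(u,v)$ denotes the intersection-over-union of two boxes. $M=1$ means that the teacher matches the ground-truth box, $M=0$ that it misses it. Expectations over $(x,c)$ and $(x,b)$ are under the corresponding marginals of $\mathcal{D}^T$. The risks are: - detection risk: $R^{\det}_{\mathcal{D}^T}(f_c,f_r)=R^{cls}_{\mathcal{D}^T,clean}(f_c)+R^{reg}_{\mathcal{D}^T,clean}(f_r)=\mathbb{E}_{(x,c)}[-\log p_c(x)]+\mathbb{E}_{(x,b)}\|f_r(x)-b\|_1$; - noisy classification risk: $R^{cls}_{\mathcal{D}^T,noisy}(f_c)=\mathbb{E}_{(x,\hat c)}[-\log p_{\hat c}(x)]$, where $\hat c$ is the pseudo-label drawn from the class-conditional transition matrix $T$; - noisy regression risk: $R^{reg}_{\mathcal{D}^T,noisy}(f_r)=\mathbb{E}_{(x,b)}\bigl[M(x,b)\,\|f_r(x)-\hat b\|_1\bigr]$.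
   Formalization: Normalization to the unit square does not imply ‖u−v‖₁ ≤ 2 (corner boxes (0,0,0,0) and (1,1,1,1) are at distance 4), so the bound is assumed separately, for a set of normalized boxes containing the ground-truth (almost surely), teacher and student boxes. *)

theory Defs
  imports "HOL-Probability.Probability"
begin

text \<open>
  The target distribution is a probability measure \<open>D\<close> on triples \<open>(x, c, b)\<close>: image, class in
  \<open>{..K}\<close>, box. The measurable space of images is given by \<open>MX\<close>. All losses are nonnegative, so
  risks are expectations in \<open>[0, \<infinity>]\<close> (type \<^typ>\<open>ennreal\<close>) and no integrability is presupposed.
\<close>

definition target_space :: "'x measure \<Rightarrow> nat \<Rightarrow> ('x \<times> nat \<times> (real^4)) measure" where
  "target_space MX K = MX \<Otimes>\<^sub>M (count_space {..K} \<Otimes>\<^sub>M borel)"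

definition cls_marginal ::
    "'x measure \<Rightarrow> nat \<Rightarrow> ('x \<times> nat \<times> (real^4)) measure \<Rightarrow> ('x \<times> nat) measure" where
  "cls_marginal MX K D = distr D (MX \<Otimes>\<^sub>M count_space {..K}) (\<lambda>(x, c, b). (x, c))"

definition box_marginal ::
    "'x measure \<Rightarrow> ('x \<times> nat \<times> (real^4)) measure \<Rightarrow> ('x \<times> (real^4)) measure" where
  "box_marginal MX D = distr D (MX \<Otimes>\<^sub>M borel) (\<lambda>(x, c, b). (x, b))"


definition l1_norm :: "real^'n \<Rightarrow> real" where
  "l1_norm u = (\<Sum>i\<in>UNIV. \<bar>u $ i\<bar>)"

text \<open>Boxes are in corner format \<open>(x\<^sub>1, y\<^sub>1, x\<^sub>2, y\<^sub>2)\<close>.\<close>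

definition box_region :: "real^4 \<Rightarrow> (real \<times> real) set" where
  "box_region u = {u $ 1 .. u $ 3} \<times> {u $ 2 .. u $ 4}"

definition unit_square_boxes :: "(real^4) set" where
  "unit_square_boxes =
     {u. 0 \<le> u $ 1 \<and> u $ 1 \<le> u $ 3 \<and> u $ 3 \<le> 1 \<and> 0 \<le> u $ 2 \<and> u $ 2 \<le> u $ 4 \<and> u $ 4 \<le> 1}"

text \<open>If both boxes have area zero, division by zero makes the value \<open>0\<close>.\<close>

definition IoU :: "real^4 \<Rightarrow> real^4 \<Rightarrow> real" where
  "IoU u v = measure lborel (box_region u \<inter> box_region v)
           / measure lborel (box_region u \<union> box_region v)"

definition match :: "real \<Rightarrow> ('x \<Rightarrow> real^4) \<Rightarrow> 'x \<Rightarrow> real^4 \<Rightarrow> real" where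
  "match \<tau> fte x b = (if IoU (fte x) b \<ge> \<tau> then 1 else 0)"


definition softmax :: "nat \<Rightarrow> (nat \<Rightarrow> real) \<Rightarrow> nat \<Rightarrow> real" where
  "softmax K z i = exp (z i) / (\<Sum>k\<le>K. exp (z k))"

definition softmax_classifier :: "'x measure \<Rightarrow> nat \<Rightarrow> ('x \<Rightarrow> nat \<Rightarrow> real) \<Rightarrow> bool" where
  "softmax_classifier MX K p \<longleftrightarrow>
     (\<exists>z. (\<forall>i\<le>K. (\<lambda>x. z x i) \<in> borel_measurable MX) \<and>
          (\<forall>x\<in>space MX. \<forall>i\<le>K. p x i = softmax K (z x) i))"

definition box_regressor :: "'x measure \<Rightarrow> (real^4) set \<Rightarrow> ('x \<Rightarrow> real^4) \<Rightarrow> bool" where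
  "box_regressor MX B f \<longleftrightarrow> f \<in> borel_measurable MX \<and> f \<in> space MX \<rightarrow> B"


definition transition_matrix :: "nat \<Rightarrow> (nat \<Rightarrow> nat \<Rightarrow> real) \<Rightarrow> bool" where
  "transition_matrix K T \<longleftrightarrow>
     (\<forall>j\<le>K. \<forall>i\<le>K. T j i \<in> {0..1}) \<and> (\<forall>j\<le>K. (\<Sum>i\<le>K. T j i) = 1)"

text \<open>
  Law of \<open>((x, c), c')\<close>, where given \<open>(x, c)\<close> the pseudo-label \<open>c'\<close> is drawn from row \<open>c\<close> of \<open>T\<close>.
  The noise is class-conditional: given \<open>c\<close>, the pseudo-label does not depend on \<open>x\<close>.
\<close>

definition pseudo_label_joint ::
    "'x measure \<Rightarrow> nat \<Rightarrow> (nat \<Rightarrow> nat \<Rightarrow> real) \<Rightarrow> ('x \<times> nat \<times> (real^4)) measure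
      \<Rightarrow> (('x \<times> nat) \<times> nat) measure" where
  "pseudo_label_joint MX K T D =
     density (cls_marginal MX K D \<Otimes>\<^sub>M count_space {..K}) (\<lambda>((x, c), c'). ennreal (T c c'))"

definition noisy_cls_marginal ::
    "'x measure \<Rightarrow> nat \<Rightarrow> (nat \<Rightarrow> nat \<Rightarrow> real) \<Rightarrow> ('x \<times> nat \<times> (real^4)) measure
      \<Rightarrow> ('x \<times> nat) measure" where
  "noisy_cls_marginal MX K T D =
     distr (pseudo_label_joint MX K T D) (MX \<Otimes>\<^sub>M count_space {..K}) (\<lambda>((x, c), c'). (x, c'))"


definition cls_risk_clean ::
    "'x measure \<Rightarrow> nat \<Rightarrow> ('x \<times> nat \<times> (real^4)) measure \<Rightarrow> ('x \<Rightarrow> nat \<Rightarrow> real) \<Rightarrow> ennreal" where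
  "cls_risk_clean MX K D p = (\<integral>\<^sup>+ (x, c). ennreal (- ln (p x c)) \<partial>cls_marginal MX K D)"

definition reg_risk_clean ::
    "'x measure \<Rightarrow> ('x \<times> nat \<times> (real^4)) measure \<Rightarrow> ('x \<Rightarrow> real^4) \<Rightarrow> ennreal" where
  "reg_risk_clean MX D f = (\<integral>\<^sup>+ (x, b). ennreal (l1_norm (f x - b)) \<partial>box_marginal MX D)"

definition det_risk ::
    "'x measure \<Rightarrow> nat \<Rightarrow> ('x \<times> nat \<times> (real^4)) measure
      \<Rightarrow> ('x \<Rightarrow> nat \<Rightarrow> real) \<Rightarrow> ('x \<Rightarrow> real^4) \<Rightarrow> ennreal" where
  "det_risk MX K D p f = cls_risk_clean MX K D p + reg_risk_clean MX D f"

definition cls_risk_noisy ::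
    "'x measure \<Rightarrow> nat \<Rightarrow> (nat \<Rightarrow> nat \<Rightarrow> real) \<Rightarrow> ('x \<times> nat \<times> (real^4)) measure
      \<Rightarrow> ('x \<Rightarrow> nat \<Rightarrow> real) \<Rightarrow> ennreal" where
  "cls_risk_noisy MX K T D p =
     (\<integral>\<^sup>+ (x, c'). ennreal (- ln (p x c')) \<partial>noisy_cls_marginal MX K T D)"

definition reg_risk_noisy ::
    "'x measure \<Rightarrow> real \<Rightarrow> ('x \<Rightarrow> real^4) \<Rightarrow> ('x \<times> nat \<times> (real^4)) measure
      \<Rightarrow> ('x \<Rightarrow> real^4) \<Rightarrow> ennreal" where
  "reg_risk_noisy MX \<tau> fte D f =
     (\<integral>\<^sup>+ (x, b). ennreal (match \<tau> fte x b * l1_norm (f x - fte x)) \<partial>box_marginal MX D)"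

definition reg_noise_rate ::
    "'x measure \<Rightarrow> real \<Rightarrow> ('x \<Rightarrow> real^4) \<Rightarrow> ('x \<times> nat \<times> (real^4)) measure \<Rightarrow> ennreal" where
  "reg_noise_rate MX \<tau> fte D =
     (\<integral>\<^sup>+ (x, b). ennreal (match \<tau> fte x b * l1_norm (fte x - b)) \<partial>box_marginal MX D)"

definition miss_rate ::
    "'x measure \<Rightarrow> real \<Rightarrow> ('x \<Rightarrow> real^4) \<Rightarrow> ('x \<times> nat \<times> (real^4)) measure \<Rightarrow> ennreal" where
  "miss_rate MX \<tau> fte D = (\<integral>\<^sup>+ (x, b). ennreal (1 - match \<tau> fte x b) \<partial>box_marginal MX D)"


text \<open>The pseudo-labels have \<open>T j i\<close> as transition probability from \<open>j\<close> to \<open>i\<close>.\<close>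

lemma emeasure_pseudo_label_joint:
  assumes D: "prob_space D" "sets D = sets (target_space MX K)"
    and A: "A \<in> sets MX" and ji: "j \<le> K" "i \<le> K"
  shows "emeasure (pseudo_label_joint MX K T D) ((A \<times> {j}) \<times> {i})
       = ennreal (T j i) * emeasure (cls_marginal MX K D) (A \<times> {j})"
proof -
  let ?C = "cls_marginal MX K D" and ?N = "count_space {..K}"
  interpret D: prob_space D by fact
  have [measurable_cong]: "sets D = sets (MX \<Otimes>\<^sub>M (?N \<Otimes>\<^sub>M borel))"
    using D(2) by (simp add: target_space_def)
  have setsC [measurable_cong]: "sets ?C = sets (MX \<Otimes>\<^sub>M ?N)"
    by (simp add: cls_marginal_def)
  interpret N: sigma_finite_measure ?N
    by (rule sigma_finite_measure_count_space_countable) simp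
  have [measurable]: "A \<times> {j} \<in> sets ?C" using A ji by (simp add: setsC)
  have "(\<lambda>(c, c'). ennreal (T c c')) \<in> borel_measurable (?N \<Otimes>\<^sub>M ?N)"
    by (simp add: pair_measure_countable)
  then have f: "(\<lambda>((x, c), c'). ennreal (T c c')) \<in> borel_measurable (?C \<Otimes>\<^sub>M ?N)"
  proof -
    assume T: "(\<lambda>(c, c'). ennreal (T c c')) \<in> borel_measurable (?N \<Otimes>\<^sub>M ?N)"
    have "(\<lambda>y. (snd (fst y), snd y)) \<in> measurable (?C \<Otimes>\<^sub>M ?N) (?N \<Otimes>\<^sub>M ?N)" by measurable
    from measurable_compose[OF this T] show ?thesis by (simp add: case_prod_unfold)
  qed
  have "emeasure (pseudo_label_joint MX K T D) ((A \<times> {j}) \<times> {i})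
      = (\<integral>\<^sup>+y. (\<lambda>((x, c), c'). ennreal (T c c')) y * indicator ((A \<times> {j}) \<times> {i}) y
           \<partial>(?C \<Otimes>\<^sub>M ?N))"
    unfolding pseudo_label_joint_def using f ji by (intro emeasure_density) auto
  also have "\<dots> = (\<integral>\<^sup>+y. ennreal (T j i) * indicator ((A \<times> {j}) \<times> {i}) y \<partial>(?C \<Otimes>\<^sub>M ?N))"
    by (intro nn_integral_cong) (auto split: split_indicator)
  also have "\<dots> = ennreal (T j i) * emeasure (?C \<Otimes>\<^sub>M ?N) ((A \<times> {j}) \<times> {i})"
    using ji by (intro nn_integral_cmult_indicator) auto
  also have "emeasure (?C \<Otimes>\<^sub>M ?N) ((A \<times> {j}) \<times> {i}) = emeasure ?C (A \<times> {j})"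
    using ji by (subst N.emeasure_pair_measure_Times) auto
  finally show ?thesis .
qed

end

theory Submission
  imports Defs
begin

text \<open>
  Classification: the noisy risk averages \<open>\<Sum>c'. T c c' * (- ln (p x c'))\<close>, whose term
  \<open>c' = c\<close> is already at least \<open>lam\<close> times the clean loss. Regression: on a match, use the
  triangle inequality through the teacher's box; on a miss, the loss is at most \<open>2\<close>.
\<close>

lemma l1_norm_triangle: "l1_norm (u - w) \<le> l1_norm (u - v) + l1_norm (v - w)"
  unfolding l1_norm_def sum.distrib[symmetric]
  by (intro sum_mono) (auto simp: abs_if)

lemma l1_norm_nonneg: "0 \<le> l1_norm u"
  by (simp add: l1_norm_def sum_nonneg)

lemma borel_measurable_vec_component [measurable]:
  "(\<lambda>u::real^'n. u $ i) \<in> borel_measurable borel"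
  by (intro borel_measurable_continuous_onI continuous_intros)

lemma borel_measurable_l1_norm [measurable]: "l1_norm \<in> borel_measurable borel"
  unfolding l1_norm_def[abs_def] by measurable

text \<open>Lebesgue measure on the plane is a product measure, so the area factors. Clipping at
  \<open>0\<close> covers empty intervals, which occur for disjoint boxes and for vectors that are
  not valid corner data.\<close>

lemma measure_rectangle:
  fixes a b c d :: real
  shows "measure lborel ({a..b} \<times> {c..d}) = max 0 (b - a) * max 0 (d - c)"
  unfolding lborel_prod[symmetric] measure_def
  by (subst lborel.emeasure_pair_measure_Times) (auto simp: emeasure_lborel_Icc_eq enn2real_mult)

text \<open>Finite area is what permits subtraction in the inclusion-exclusion formula for unions of
  boxes.\<close>

lemma box_region_fmeasurable: "box_region u \<in> fmeasurable lborel"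
proof -
  have "box_region u = cbox (u $ 1, u $ 2) (u $ 3, u $ 4)"
    by (simp add: box_region_def cbox_Pair_eq)
  then show ?thesis
    by simp
qed

lemma measure_box_region:
  "measure lborel (box_region u) = max 0 (u $ 3 - u $ 1) * max 0 (u $ 4 - u $ 2)"
  by (simp add: box_region_def measure_rectangle)

lemma measure_box_region_Int:
  "measure lborel (box_region u \<inter> box_region v)
     = max 0 (min (u $ 3) (v $ 3) - max (u $ 1) (v $ 1))
       * max 0 (min (u $ 4) (v $ 4) - max (u $ 2) (v $ 2))"
  by (simp add: box_region_def Times_Int_Times measure_rectangle)

text \<open>Inclusion-exclusion replaces the area of the union, which is not a rectangle, by areas
  of rectangles. \<open>IoU\<close> thereby becomes an expression in the coordinates built from
  arithmetic, \<open>min\<close> and \<open>max\<close>; division stays Borel measurable with the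
  value \<open>0\<close> at denominator \<open>0\<close>.\<close>

lemma borel_measurable_IoU [measurable (raw)]:
  assumes [measurable]: "f \<in> borel_measurable M" "g \<in> borel_measurable M"
  shows "(\<lambda>y. IoU (f y) (g y)) \<in> borel_measurable M"
proof -
  have "measure lborel (box_region u \<union> box_region v)
      = measure lborel (box_region u) + measure lborel (box_region v)
        - measure lborel (box_region u \<inter> box_region v)" for u v
    by (rule measure_Un3) (auto intro: box_region_fmeasurable)
  then show ?thesis
    unfolding IoU_def measure_box_region_Int measure_box_region by simp
qed

lemma borel_measurable_match [measurable (raw)]:
  assumes [measurable]: "fte \<in> borel_measurable MX"
  shows "(\<lambda>(x, b). match \<tau> fte x b) \<in> borel_measurable (MX \<Otimes>\<^sub>M borel)"
  unfolding match_def by measurable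

text \<open>The values of \<open>p\<close> are prescribed only on \<open>space MX\<close> and for
  classes up to \<open>K\<close>, so measurability is transferred from the softmax one class at a
  time. The finitely many sections are then glued along the class coordinate.\<close>

lemma borel_measurable_softmax_classifier:
  assumes "softmax_classifier MX K p"
  shows "(\<lambda>(x, c). p x c) \<in> borel_measurable (MX \<Otimes>\<^sub>M count_space {..K})"
proof -
  obtain z where z: "\<And>i. i \<le> K \<Longrightarrow> (\<lambda>x. z x i) \<in> borel_measurable MX"
    and p: "\<And>x i. x \<in> space MX \<Longrightarrow> i \<le> K \<Longrightarrow> p x i = softmax K (z x) i"
    using assms by (auto simp: softmax_classifier_def)
  have [measurable]: "(\<lambda>x. softmax K (z x) i) \<in> borel_measurable MX" if "i \<le> K" for i
    using that z unfolding softmax_def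
    by (intro borel_measurable_divide borel_measurable_sum
        measurable_compose[OF _ borel_measurable_exp]) auto
  then have "(\<lambda>x. p x i) \<in> borel_measurable MX" if "i \<le> K" for i
    using that p measurable_cong[of MX "\<lambda>x. p x i" "\<lambda>x. softmax K (z x) i" borel] by auto
  then show ?thesis
    unfolding case_prod_unfold
    by (intro measurable_compose_countable'[where f = "\<lambda>i y. p (fst y) i" and g = snd and I = "{..K}"]
        measurable_compose[OF measurable_fst]) auto
qed

text \<open>Expresses the noisy risk over the clean marginal: unfold the image measure and the
  density, then integrate out the pseudo-label by Tonelli.\<close>

lemma nn_integral_noisy_cls_marginal:
  fixes g :: "'x \<times> nat \<Rightarrow> ennreal"
  assumes g [measurable]: "g \<in> borel_measurable (MX \<Otimes>\<^sub>M count_space {..K})"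
  shows "(\<integral>\<^sup>+ y. g y \<partial>noisy_cls_marginal MX K T D)
       = (\<integral>\<^sup>+ (x, c). (\<Sum>i\<le>K. ennreal (T c i) * g (x, i)) \<partial>cls_marginal MX K D)"
proof -
  let ?C = "cls_marginal MX K D" and ?N = "count_space {..K}"
  have [measurable_cong]: "sets ?C = sets (MX \<Otimes>\<^sub>M ?N)"
    by (simp add: cls_marginal_def)
  interpret N: sigma_finite_measure ?N
    by (rule sigma_finite_measure_count_space_countable) simp
  \<comment> \<open>The product of two countable discrete spaces is discrete, so any matrix is
    measurable on it.\<close>
  have "(\<lambda>(c, c'). ennreal (T c c')) \<in> borel_measurable (?N \<Otimes>\<^sub>M ?N)"
    by (simp add: pair_measure_countable)
  from measurable_compose[OF _ this, of "\<lambda>y. (snd (fst y), snd y)" "?C \<Otimes>\<^sub>M ?N"]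
  have T [measurable]: "(\<lambda>((x, c), c'). ennreal (T c c')) \<in> borel_measurable (?C \<Otimes>\<^sub>M ?N)"
    by (simp add: case_prod_unfold)
  have "(\<lambda>y. (fst (fst y), snd y)) \<in> measurable (?C \<Otimes>\<^sub>M ?N) (MX \<Otimes>\<^sub>M ?N)"
    by measurable
  then have [measurable]: "(\<lambda>((x, c), c'). (x, c')) \<in> measurable (?C \<Otimes>\<^sub>M ?N) (MX \<Otimes>\<^sub>M ?N)"
    by (simp add: case_prod_unfold)
  have "(\<integral>\<^sup>+ y. g y \<partial>noisy_cls_marginal MX K T D)
      = (\<integral>\<^sup>+ y. g ((\<lambda>((x, c), c'). (x, c')) y) \<partial>pseudo_label_joint MX K T D)"
    unfolding noisy_cls_marginal_def
    by (intro nn_integral_distr) (simp_all add: pseudo_label_joint_def)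
  also have "\<dots> = (\<integral>\<^sup>+ y. (\<lambda>((x, c), c'). ennreal (T c c')) y * g ((\<lambda>((x, c), c'). (x, c')) y)
                    \<partial>(?C \<Otimes>\<^sub>M ?N))"
    unfolding pseudo_label_joint_def by (intro nn_integral_density) measurable
  \<comment> \<open>Tonelli with the pseudo-label innermost, where the counting measure is
    sigma-finite.\<close>
  also have "\<dots> = (\<integral>\<^sup>+ y. (\<integral>\<^sup>+ i. ennreal (T (snd y) i) * g (fst y, i) \<partial>?N) \<partial>?C)"
    by (subst N.nn_integral_fst[symmetric]) (measurable, simp_all add: case_prod_unfold)
  also have "\<dots> = (\<integral>\<^sup>+ (x, c). (\<Sum>i\<le>K. ennreal (T c i) * g (x, i)) \<partial>?C)"
    by (simp add: nn_integral_count_space_finite case_prod_unfold)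
  finally show ?thesis .
qed

lemma cls_risk_clean_le_noisy:
  assumes lam: "0 < lam" "\<And>c. c \<le> K \<Longrightarrow> lam \<le> T c c"
    and p: "(\<lambda>(x, c). p x c) \<in> borel_measurable (MX \<Otimes>\<^sub>M count_space {..K})"
  shows "cls_risk_clean MX K D p \<le> ennreal (1 / lam) * cls_risk_noisy MX K T D p"
proof -
  let ?C = "cls_marginal MX K D" and ?l = "\<lambda>(x, c). ennreal (- ln (p x c))"
  have l: "?l \<in> borel_measurable (MX \<Otimes>\<^sub>M count_space {..K})"
    using p by (simp add: case_prod_unfold)
  have lC: "?l \<in> borel_measurable ?C"
    using l by (simp add: cls_marginal_def)
  have "ennreal lam * cls_risk_clean MX K D p = (\<integral>\<^sup>+ y. ennreal lam * ?l y \<partial>?C)"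
    unfolding cls_risk_clean_def using lC by (simp add: nn_integral_cmult)
  also have "\<dots> \<le> (\<integral>\<^sup>+ (x, c). (\<Sum>i\<le>K. ennreal (T c i) * ?l (x, i)) \<partial>?C)"
  proof (rule nn_integral_mono)
    fix y assume "y \<in> space ?C"
    then obtain x c where y: "y = (x, c)" and c: "c \<le> K"
      by (auto simp: cls_marginal_def space_pair_measure)
    have "ennreal lam * ?l (x, c) \<le> ennreal (T c c) * ?l (x, c)"
      by (intro mult_right_mono ennreal_leI lam c) auto
    \<comment> \<open>The off-diagonal terms are nonnegative as elements of \<open>ennreal\<close>,
      so the diagonal term is below the sum.\<close>
    also have "\<dots> \<le> (\<Sum>i\<le>K. ennreal (T c i) * ?l (x, i))"
      using c by (intro member_le_sum) auto
    finally show "ennreal lam * ?l y \<le> (case y of (x, c) \<Rightarrow> \<Sum>i\<le>K. ennreal (T c i) * ?l (x, i))"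
      by (simp add: y)
  qed
  also have "\<dots> = cls_risk_noisy MX K T D p"
    unfolding cls_risk_noisy_def by (rule nn_integral_noisy_cls_marginal[OF l, symmetric])
  \<comment> \<open>Multiplying by the finite inverse of \<open>lam\<close> isolates the clean risk
    even when the risks are infinite.\<close>
  finally have "ennreal (1 / lam) * (ennreal lam * cls_risk_clean MX K D p)
      \<le> ennreal (1 / lam) * cls_risk_noisy MX K T D p"
    by (rule mult_left_mono) simp
  moreover have "ennreal (1 / lam) * ennreal lam = 1"
    using lam(1) by (simp flip: ennreal_mult')
  ultimately show ?thesis
    by (simp flip: mult.assoc)
qed

lemma reg_risk_clean_le_noisy:
  assumes bound: "\<And>u v. u \<in> Boxes \<Longrightarrow> v \<in> Boxes \<Longrightarrow> l1_norm (u - v) \<le> 2"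
    and AE: "AE (x, b) in box_marginal MX D. b \<in> Boxes"
    and fte [measurable]: "fte \<in> borel_measurable MX"
    and f: "box_regressor MX Boxes f"
  shows "reg_risk_clean MX D f
       \<le> reg_risk_noisy MX \<tau> fte D f + reg_noise_rate MX \<tau> fte D + 2 * miss_rate MX \<tau> fte D"
proof -
  let ?B = "box_marginal MX D" and ?M = "\<lambda>x b. match \<tau> fte x b"
  have [measurable]: "f \<in> borel_measurable MX" and fB: "\<And>x. x \<in> space MX \<Longrightarrow> f x \<in> Boxes"
    using f by (auto simp: box_regressor_def)
  have [measurable_cong]: "sets ?B = sets (MX \<Otimes>\<^sub>M borel)"
    by (simp add: box_marginal_def)
  have [measurable]: "(\<lambda>y. ?M (fst y) (snd y)) \<in> borel_measurable ?B"
    using borel_measurable_match[OF fte, of \<tau>]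
    by (simp add: case_prod_unfold cong: measurable_cong_sets)
  \<comment> \<open>Since \<open>match\<close> takes only the values \<open>0\<close> and
    \<open>1\<close>, either the last summand vanishes or the first two do and the last equals
    \<open>2\<close>.\<close>
  have "ennreal (l1_norm (f x - b))
      \<le> ennreal (?M x b * l1_norm (f x - fte x)) + ennreal (?M x b * l1_norm (fte x - b))
        + 2 * ennreal (1 - ?M x b)"
    if "x \<in> space MX" "b \<in> Boxes" for x b
    using bound[OF fB[OF that(1)] that(2)] l1_norm_triangle[of "f x" b "fte x"]
    by (auto simp: match_def l1_norm_nonneg ennreal_leI simp flip: ennreal_plus
        intro: order_trans[OF ennreal_leI])
  \<comment> \<open>The true box lies in \<open>Boxes\<close> only almost everywhere, whereas
    \<open>f x\<close> does for every \<open>x\<close> in the space; hence monotonicity is applied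
    in its almost-everywhere form.\<close>
  then have "reg_risk_clean MX D f
      \<le> (\<integral>\<^sup>+ y. ennreal (?M (fst y) (snd y) * l1_norm (f (fst y) - fte (fst y)))
            + ennreal (?M (fst y) (snd y) * l1_norm (fte (fst y) - snd y))
            + 2 * ennreal (1 - ?M (fst y) (snd y)) \<partial>?B)"
    unfolding reg_risk_clean_def using AE
    by (intro nn_integral_mono_AE, elim AE_mp)
      (auto intro!: AE_I2 simp: box_marginal_def space_pair_measure)
  \<comment> \<open>Splitting the integral requires measurable summands; this is where the
    measurability of \<open>match\<close>, and thus of \<open>IoU\<close>, enters.\<close>
  also have "\<dots> = reg_risk_noisy MX \<tau> fte D f + reg_noise_rate MX \<tau> fte D + 2 * miss_rate MX \<tau> fte D"
    unfolding reg_risk_noisy_def reg_noise_rate_def miss_rate_def case_prod_unfold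
    by (simp add: nn_integral_add nn_integral_cmult)
  finally show ?thesis .
qed

theorem theorem1:
  fixes MX :: "'x measure" and K :: nat and D :: "('x \<times> nat \<times> (real^4)) measure"
    and T :: "nat \<Rightarrow> nat \<Rightarrow> real" and lam \<tau> :: real
    and Boxes :: "(real^4) set"
    and f_r_te f_r_st :: "'x \<Rightarrow> real^4" and f_c_st :: "'x \<Rightarrow> nat \<Rightarrow> real"
  assumes "prob_space D" and "sets D = sets (target_space MX K)"
    and "transition_matrix K T"
    and "lam = Min ((\<lambda>j. T j j) ` {..K})" and "lam > 0"
    and "Boxes \<subseteq> unit_square_boxes"
    and "\<And>u v. u \<in> Boxes \<Longrightarrow> v \<in> Boxes \<Longrightarrow> l1_norm (u - v) \<le> 2"
    and "AE (x, b) in box_marginal MX D. b \<in> Boxes"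
    and "box_regressor MX Boxes f_r_te"
    and "softmax_classifier MX K f_c_st"
    and "box_regressor MX Boxes f_r_st"
  shows "det_risk MX K D f_c_st f_r_st
         \<le> ennreal (1 / lam) * cls_risk_noisy MX K T D f_c_st
           + reg_risk_noisy MX \<tau> f_r_te D f_r_st
           + reg_noise_rate MX \<tau> f_r_te D
           + 2 * miss_rate MX \<tau> f_r_te D"
proof -
  have "lam \<le> T c c" if "c \<le> K" for c
    using that unfolding assms(4) by (intro Min_le) auto
  then have "cls_risk_clean MX K D f_c_st \<le> ennreal (1 / lam) * cls_risk_noisy MX K T D f_c_st"
    by (intro cls_risk_clean_le_noisy borel_measurable_softmax_classifier assms)
  moreover have "reg_risk_clean MX D f_r_st
      \<le> reg_risk_noisy MX \<tau> f_r_te D f_r_st + reg_noise_rate MX \<tau> f_r_te D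
        + 2 * miss_rate MX \<tau> f_r_te D"
    using assms(9) by (intro reg_risk_clean_le_noisy[of Boxes] assms(7,8,11))
      (auto simp: box_regressor_def)
  \<comment> \<open>The detection risk is the sum of the two clean risks, and addition in
    \<open>ennreal\<close> is monotone for infinite values too.\<close>
  ultimately show ?thesis
    unfolding det_risk_def by (auto dest: add_mono simp: add.assoc)
qed

end
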